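(* Let $a_1, a_2, a_3 \in \mathbb{N}$. Then the $a_i$ can be renumbered in such a way that $a_1 \geq a_2 \oplus a_3$; that is, there is a permutation $\sigma$ of $\{1,2,3\}$ such that $a_{\sigma(1)} \geq a_{\sigma(2)} \oplus a_{\sigma(3)}$.
   Context: $\mathbb{N}$ denotes the set of natural numbers including $0$, with its usual order. For $a,b\in\mathbb{N}$ with binary expansions $a = a_0 + a_1 2^1 + a_2 2^2 + \cdots$ and $b = b_0 + b_1 2^1 + b_2 2^2 + \cdots$ (all $a_i,b_i\in\{0,1\}$), the Nim sum is $a\oplus b = (a_0\oplus b_0) + (a_1\oplus b_1)2^1 + (a_2\oplus b_2)2^2+\cdots$, where $0\oplus 0 = 1\oplus 1 = 0$ and $0\oplus 1 = 1\oplus 0 = 1$ (bitwise exclusive or). *)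

theory Defs
  imports Main "HOL-Combinatorics.Permutations"
begin

text \<open>The Nim sum on the natural numbers is the library's bitwise exclusive or.\<close>

abbreviation nim_sum :: "nat \<Rightarrow> nat \<Rightarrow> nat" (infixl "\<oplus>" 65)
  where "a \<oplus> b \<equiv> Bit_Operations.xor a b"

end

theory Submission
  imports Defs
begin

text \<open>
  Put \<open>s = a \<oplus> b \<oplus> c\<close>. If \<open>s = 0\<close>, each of the three numbers equals the Nim sum of the other
  two. Otherwise the leading binary digit of \<open>s\<close> is \<open>1\<close>, so an odd count of the three have a \<open>1\<close> there, hence
  at least one of them does, say \<open>a\<close>. Then \<open>b \<oplus> c = a \<oplus> s\<close> agrees with \<open>a\<close> above
  that digit and has \<open>0\<close> there, so \<open>b \<oplus> c < a\<close>. This is the winning move in the game of Nim with heaps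
  \<open>a\<close>, \<open>b\<close>, \<open>c\<close>, and it is the content of \<open>nim_sum_winning_move\<close> below. The leading digit of \<open>s\<close> is
  reached by removing the last digits of the three numbers one at a time.
\<close>

lemma nim_sum_less_if_halves:
  fixes a b c :: nat
  assumes "b div 2 \<oplus> c div 2 < a div 2"
  shows "b \<oplus> c < a"
proof -
  have "(b \<oplus> c) div 2 < a div 2"
    using assms by (simp add: xor_rec [of b c])
  then show ?thesis
    by linarith
qed

text \<open>
  The induction removes the last binary digit of each number. A strict inequality between the
  remaining parts survives when the digits are put back. If the remaining parts have Nim sum \<open>0\<close>,
  the three numbers differ from a position with Nim sum \<open>0\<close> only in their last digits; an odd
  number of these are \<open>1\<close>, and whichever of the three is odd exceeds the Nim sum of the other two
  by one. The hypothesis \<open>b \<oplus> c \<noteq> a\<close> says that \<open>a \<oplus> b \<oplus> c\<close> is nonzero.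
\<close>

lemma nim_sum_winning_move:
  fixes a b c :: nat
  assumes "b \<oplus> c \<noteq> a"
  shows "b \<oplus> c < a \<or> a \<oplus> c < b \<or> b \<oplus> a < c"
  using assms
proof (induction "a + b + c" arbitrary: a b c rule: less_induct)
  case less
  let ?a = "a div 2" and ?b = "b div 2" and ?c = "c div 2"
  show ?case
  proof (cases "?b \<oplus> ?c = ?a")
    case False
    have "a \<noteq> 0 \<or> b \<noteq> 0 \<or> c \<noteq> 0"
      using less.prems by auto
    then have "?a + ?b + ?c < a + b + c"
      by linarith
    from less.hyps [OF this False] show ?thesis
      using nim_sum_less_if_halves by blast
  next
    case True
    then have halves: "?a \<oplus> ?c = ?b" "?b \<oplus> ?a = ?c"
      by (auto simp flip: True simp: xor.assoc) (simp flip: xor.assoc)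
    have parity: "odd a \<longleftrightarrow> (odd b \<longleftrightarrow> odd c)"
    proof (rule ccontr)
      assume "\<not> ?thesis"
      then have "b \<oplus> c = of_bool (odd a) + 2 * ?a"
        using True by (auto simp: xor_rec [of b c])
      also have "\<dots> = a"
        by (simp add: mod2_eq_if [symmetric] of_bool_odd_eq_mod_2)
      finally show False
        using less.prems by contradiction
    qed
    \<comment> \<open>The Nim sum of the last digits is \<open>1\<close>, so one of the three digits is \<open>1\<close>, and the
      other two then have Nim sum \<open>0\<close>.\<close>
    then consider "odd a" "odd b = odd c" | "odd b" "odd a = odd c" | "odd c" "odd b = odd a"
      by blast
    then show ?thesis
    proof cases
      case 1
      then have "b \<oplus> c = 2 * ?a"
        using True by (simp add: xor_rec [of b c])
      with \<open>odd a\<close> show ?thesis by presburger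
    next
      case 2
      then have "a \<oplus> c = 2 * ?b"
        using halves by (simp add: xor_rec [of a c])
      with \<open>odd b\<close> show ?thesis by presburger
    next
      case 3
      then have "b \<oplus> a = 2 * ?c"
        using halves by (simp add: xor_rec [of b a])
      with \<open>odd c\<close> show ?thesis by presburger
    qed
  qed
qed

text \<open>
  Since the Nim sum is commutative, only the choice of \<open>\<sigma> 1\<close> matters, and the identity or a
  transposition moving the right index to the first place suffices.
\<close>

theorem lemma2p4:
  fixes a :: "nat \<Rightarrow> nat"
  shows "\<exists>\<sigma>. \<sigma> permutes {1, 2, 3 :: nat} \<and> a (\<sigma> 1) \<ge> a (\<sigma> 2) \<oplus> a (\<sigma> 3)"
proof -
  consider "a 2 \<oplus> a 3 \<le> a 1" | "a 1 \<oplus> a 3 \<le> a 2" | "a 2 \<oplus> a 1 \<le> a 3"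
    using nim_sum_winning_move [of "a 2" "a 3" "a 1"] by fastforce
  then show ?thesis
  proof cases
    case 1
    then show ?thesis
      by (intro exI [of _ id]) (simp add: permutes_id)
  next
    case 2
    then show ?thesis
      by (intro exI [of _ "transpose 1 2"]) (simp add: permutes_swap_id)
  next
    case 3
    then show ?thesis
      by (intro exI [of _ "transpose 1 3"]) (simp add: permutes_swap_id)
  qed
qed

end
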